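(* Let $S_1=\{(\pm1,0),(0,\pm1)\}$ and $S_2=\{(\pm1,0),(\pm2,0),(0,\pm1)\}$ in $\mathbb{Z}^2$. The Cayley graph $\mathrm{Cay}(\mathbb{Z}^2,S_1)$ is minor excluded, while the Cayley graph $\mathrm{Cay}(\mathbb{Z}^2,S_2)$ is not minor excluded.
   Context: Cayley graph: for a group $G$ and a finite generating set $S$ that is symmetric ($s\in S$ iff $s^{-1}\in S$) and does not contain the identity, $\mathrm{Cay}(G,S)$ is the graph with vertex set $G$ in which $u,v\in G$ are adjacent if and only if $u=sv$ for some $s\in S$ (for $\mathbb{Z}^2$, written additively, $u=s+v$). Minor: a finite graph $M$ is a minor of a connected graph $\Gamma$ if there is a finite set $\{V_i\}$ of pairwise-disjoint (nonempty) finite connected subgraphs of $\Gamma$ (branch sets), in one-to-one correspondence with the set of vertices $\{v_i\}$ of $M$, such that for every edge of $M$ between $v_i$ and $v_j$ there is an edge of $\Gamma$ between $V_i$ and $V_j$. The graph $\Gamma$ is minor excluded if there is a finite graph that is not a minor of $\Gamma$; equivalently, if there is a natural number $m$ such that the complete graph $K_m$ is not a minor of $\Gamma$. *)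

theory Defs
  imports "Graph_Theory.Digraph_Component" "HOL-Library.Product_Plus"
begin

text \<open>
  An undirected graph is a symmetric digraph without parallel arcs: the edge between u and v is the
  pair of arcs (u, v), (v, u). Finite simple graphs are the instances of \<^locale>\<open>pair_graph\<close>;
  possibly infinite ones are the instances of \<^locale>\<open>pair_bidirected_digraph\<close>.
\<close>

definition connection_set :: "'a::group_add set \<Rightarrow> bool" where
  "connection_set S \<longleftrightarrow>
     finite S \<and> 0 \<notin> S \<and> (\<forall>s. s \<in> S \<longleftrightarrow> - s \<in> S) \<and>
     (\<forall>H. S \<subseteq> H \<and> 0 \<in> H \<and> (\<forall>x\<in>H. - x \<in> H) \<and> (\<forall>x\<in>H. \<forall>y\<in>H. x + y \<in> H) \<longrightarrow> H = UNIV)"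

text \<open>The requirements on S are not built in; they are \<^const>\<open>connection_set\<close>.\<close>

definition Cay :: "'a::group_add set \<Rightarrow> 'a pair_pre_digraph" where
  "Cay S = \<lparr> pverts = UNIV, parcs = {(u, v). \<exists>s\<in>S. u = s + v} \<rparr>"

text \<open>
  Branch sets are subgraphs, not vertex sets, and need not be induced. They are nonempty because
  \<^const>\<open>connected\<close> excludes the graph without vertices, so disjointness makes B injective.
\<close>

definition is_minor :: "'v pair_pre_digraph \<Rightarrow> 'a pair_pre_digraph \<Rightarrow> bool" where
  "is_minor M G \<longleftrightarrow>
     (\<exists>B :: 'v \<Rightarrow> 'a pair_pre_digraph.
        (\<forall>i\<in>pverts M. pair_graph (B i) \<and> subgraph (B i) G \<and> connected (B i)) \<and>
        (\<forall>i\<in>pverts M. \<forall>j\<in>pverts M. i \<noteq> j \<longrightarrow> pverts (B i) \<inter> pverts (B j) = {}) \<and>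
        (\<forall>(i, j)\<in>parcs M. \<exists>x\<in>pverts (B i). \<exists>y\<in>pverts (B j). (x, y) \<in> parcs G))"

text \<open>Every finite graph is isomorphic to one whose vertices are natural numbers.\<close>

definition minor_excluded :: "'a pair_pre_digraph \<Rightarrow> bool" where
  "minor_excluded G \<longleftrightarrow> (\<exists>M :: nat pair_pre_digraph. pair_graph M \<and> \<not> is_minor M G)"

lemma pair_bidirected_digraph_Cay:
  assumes "connection_set S"
  shows "pair_bidirected_digraph (Cay S)"
proof -
  have 0: "0 \<notin> S" and neg: "\<And>s. s \<in> S \<Longrightarrow> - s \<in> S"
    using assms unfolding connection_set_def by blast+
  show ?thesis
  proof
    show "symmetric (Cay S)"
      unfolding symmetric_def
    proof (rule symI)
      fix u v assume "(u, v) \<in> arcs_ends (Cay S)"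
      then obtain s where s: "s \<in> S" "u = s + v" by (auto simp: Cay_def)
      then have "- s \<in> S" "v = - s + u" using neg by (simp_all add: add.assoc[symmetric])
      then show "(v, u) \<in> arcs_ends (Cay S)" by (auto simp: Cay_def)
    qed
  next
    fix e assume "e \<in> parcs (Cay S)"
    then obtain s v where "s \<in> S" "e = (s + v, v)" by (auto simp: Cay_def)
    moreover have "s + v \<noteq> v" using 0 \<open>s \<in> S\<close> by (metis add_diff_cancel diff_self)
    ultimately show "fst e \<noteq> snd e" by simp
  qed (simp_all add: Cay_def)
qed

lemma connected_Cay:
  fixes S :: "'a::group_add set"
  assumes S: "connection_set S"
  shows "connected (Cay S)"
proof -
  have gen: "H = UNIV"
    if "S \<subseteq> H" "0 \<in> H" "\<And>x. x \<in> H \<Longrightarrow> - x \<in> H" "\<And>x y. x \<in> H \<Longrightarrow> y \<in> H \<Longrightarrow> x + y \<in> H" for H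
    using S that unfolding connection_set_def by simp
  let ?E = "parcs (Cay S)"
  let ?H = "{x. \<forall>v. (x + v, v) \<in> ?E\<^sup>*}"
  have symE: "sym (?E\<^sup>*)"
    using pair_sym_digraph.pair_sym_arcs
      [OF pair_bidirected_digraph.axioms(1), OF pair_bidirected_digraph_Cay, OF S]
    by (simp add: symmetric_def sym_rtrancl)
  have H1: "S \<subseteq> ?H" by (auto simp: Cay_def)
  have H2: "0 \<in> ?H" by simp
  have H3: "- x \<in> ?H" if x: "x \<in> ?H" for x
  proof (clarify)
    fix v
    have "(x + (- x + v), - x + v) \<in> ?E\<^sup>*" using x by blast
    then have "(v, - x + v) \<in> ?E\<^sup>*" by (simp add: add.assoc[symmetric])
    then show "(- x + v, v) \<in> ?E\<^sup>*" by (rule symD[OF symE])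
  qed
  have H4: "x + y \<in> ?H" if "x \<in> ?H" "y \<in> ?H" for x y
  proof (clarify)
    fix v
    have "(x + (y + v), y + v) \<in> ?E\<^sup>*" "(y + v, v) \<in> ?E\<^sup>*" using that by blast+
    then show "(x + y + v, v) \<in> ?E\<^sup>*" unfolding add.assoc by (rule rtrancl_trans)
  qed
  have H: "?H = UNIV"
    by (rule gen[OF H1 H2 H3 H4])
  have E: "(u, v) \<in> ?E\<^sup>*" for u v
  proof -
    have "((u - v) + v, v) \<in> ?E\<^sup>*" using H by blast
    then show ?thesis by simp
  qed
  have "?E \<subseteq> parcs (mk_symmetric (Cay S))"
    by (auto simp: mk_symmetric_def)
  then have "(u, v) \<in> (parcs (mk_symmetric (Cay S)))\<^sup>*" for u v
    using E rtrancl_mono by blast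
  then have "(u, v) \<in> rtrancl_on UNIV (parcs (mk_symmetric (Cay S)))" for u v
    by (rule rtrancl_consistent_rtrancl_on) simp_all
  then show ?thesis
    by (auto simp: connected_def strongly_connected_def reachable_def mk_symmetric_def Cay_def)
qed

lemma connection_set_int_prodI:
  fixes S :: "(int \<times> int) set"
  assumes fin: "finite S" and zero: "0 \<notin> S" and neg: "\<And>s. s \<in> S \<Longrightarrow> - s \<in> S"
    and gens: "(1, 0) \<in> S" "(0, 1) \<in> S"
  shows "connection_set S"
  unfolding connection_set_def
proof (intro conjI allI impI)
  fix s show "s \<in> S \<longleftrightarrow> - s \<in> S" using neg[of s] neg[of "- s"] by auto
next
  fix H :: "(int \<times> int) set"
  assume "S \<subseteq> H \<and> 0 \<in> H \<and> (\<forall>x\<in>H. - x \<in> H) \<and> (\<forall>x\<in>H. \<forall>y\<in>H. x + y \<in> H)"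
  then have H0: "0 \<in> H" and Hneg: "\<And>x. x \<in> H \<Longrightarrow> - x \<in> H"
    and Hadd: "\<And>x y. x \<in> H \<Longrightarrow> y \<in> H \<Longrightarrow> x + y \<in> H"
    and e1: "(1, 0) \<in> H" and e2: "(0, 1) \<in> H"
    using gens by blast+
  have nat1: "(int n, 0) \<in> H" for n
  proof (induction n)
    case 0 then show ?case using H0 by (simp add: zero_prod_def)
  next
    case (Suc n) then show ?case using Hadd[OF e1] by fastforce
  qed
  have nat2: "(0, int n) \<in> H" for n
  proof (induction n)
    case 0 then show ?case using H0 by (simp add: zero_prod_def)
  next
    case (Suc n) then show ?case using Hadd[OF e2] by fastforce
  qed
  have int1: "(a, 0) \<in> H" for a
    using nat1 Hneg[OF nat1] by (cases a rule: int_cases2) auto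
  have int2: "(0, b) \<in> H" for b
    using nat2 Hneg[OF nat2] by (cases b rule: int_cases2) auto
  have "(a, b) \<in> H" for a b
    using Hadd[OF int1 int2, of a b] by simp
  then show "H = UNIV" by auto
qed (use fin zero in blast)+

lemma connection_set_S1:
  "connection_set {(1, 0), (-1, 0), (0, 1), (0, -1) :: int \<times> int}"
  by (rule connection_set_int_prodI) (auto simp: zero_prod_def)

lemma connection_set_S2:
  "connection_set {(1, 0), (-1, 0), (2, 0), (-2, 0), (0, 1), (0, -1) :: int \<times> int}"
  by (rule connection_set_int_prodI) (auto simp: zero_prod_def)

end

theory Submission
  imports Defs "HOL-Library.Z2" "HOL-Library.FuncSet"
begin

text \<open>
  Nearest-neighbour grid: it has no \<open>K\<^sub>5\<close> minor, by a homological form of Euler's formula. Over the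
  field with two elements every finite cycle of the grid is the coboundary of a function on the unit
  squares. Given branch sets of \<open>K\<^sub>5\<close>, take a minimal set H of grid edges to which every cycle of
  \<open>K\<^sub>5\<close> lifts. The lifts of the \<open>2\<^sup>6\<close> cycles of \<open>K\<^sub>5\<close> are coboundaries of two functions
  each, and these \<open>2\<^sup>7\<close> functions are constant on the regions cut out by H, so there are at least 7
  regions.
  The boundary of a region is a cycle in H; by minimality it contracts to a nonzero cycle of \<open>K\<^sub>5\<close>,
  which has at least 3 edges. As each of the 10 edges borders at most two regions, this gives
  21 \<open>\<le>\<close> 20.

  Grid with double steps: branch set number i is the set of even points of row i together with
  column 2i + 1. Double steps let a row jump over the columns.
\<close>

section \<open>Cycles modulo 2\<close>

text \<open>Rewriting addition and multiplication of bits to XOR and AND would hide the field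
  structure on which the sum lemmas rely.\<close>

declare add_bit_eq_xor [simp del] mult_bit_eq_and [simp del]

lemma bit_add_self [simp]: "a + a = (0::bit)"
  by (cases a) simp_all

lemma bit_add_left_self [simp]: "a + (a + b) = (b::bit)"
  by (simp add: add.assoc[symmetric])

lemma bit_add_eq_0_iff: "a + b = 0 \<longleftrightarrow> a = (b::bit)"
  by (cases a; cases b) simp_all

text \<open>A cycle is encoded as the symmetric indicator function of an edge set with even degrees.\<close>

definition cycles :: "'a set \<Rightarrow> 'a rel \<Rightarrow> ('a \<Rightarrow> 'a \<Rightarrow> bit) set" where
  "cycles W H =
     {c. (\<forall>p q. c p q = c q p) \<and> (\<forall>p q. (p, q) \<notin> H \<longrightarrow> c p q = 0) \<and>
         (\<forall>p\<in>W. (\<Sum>q\<in>W. c p q) = 0)}"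

lemma cyclesD:
  assumes "c \<in> cycles W H"
  shows "c p q = c q p" "c p q = 1 \<Longrightarrow> (p, q) \<in> H" "p \<in> W \<Longrightarrow> (\<Sum>q\<in>W. c p q) = 0"
  using assms unfolding cycles_def by (blast, force, blast)

lemma cycles_add:
  assumes "c \<in> cycles W H" "d \<in> cycles W H"
  shows "(\<lambda>p q. c p q + d p q) \<in> cycles W H"
  using assms by (simp add: cycles_def sum.distrib)

text \<open>Modulo 2 the equal entries at (p, q) and (q, p) cancel. Hence edges inside a vertex set
  contribute nothing to the sum of its degrees.\<close>

lemma sum_sym_eq_0:
  fixes c :: "'a \<Rightarrow> 'a \<Rightarrow> bit"
  assumes "finite A" and sym: "\<And>p q. c p q = c q p" and diag: "\<And>p. c p p = 0"
  shows "(\<Sum>p\<in>A. \<Sum>q\<in>A. c p q) = 0"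
  using \<open>finite A\<close>
proof (induction A rule: finite_induct)
  case (insert x A)
  have "(\<Sum>p\<in>A. c p x) = (\<Sum>p\<in>A. c x p)" by (intro sum.cong refl sym)
  with insert show ?case by (simp add: diag sum.distrib)
qed simp

text \<open>A sum with exactly one nonzero term cannot vanish. For degrees: a cycle that enters a
  vertex leaves it by another edge.\<close>

lemma bit_sum_eq_0_obtain_other:
  fixes f :: "'a \<Rightarrow> bit"
  assumes "finite W" "(\<Sum>q\<in>W. f q) = 0" "x \<in> W" "f x = 1"
  obtains y where "y \<in> W" "y \<noteq> x" "f y = 1"
proof -
  have "(\<Sum>q\<in>W - {x}. f q) \<noteq> 0"
    using assms by (simp add: sum.remove[of W x f])
      (metis add_cancel_left_right bit_add_eq_0_iff one_neq_zero)
  then obtain y where "y \<in> W - {x}" "f y \<noteq> 0" by (meson sum.not_neutral_contains_not_neutral)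
  then show ?thesis using that by auto
qed

text \<open>An edge ij of the cycle continues from i to some k and from j to some l. These are three
  distinct edges, even if k = l, and each counts twice, once per direction.\<close>

lemma cycle_card_ge_6:
  assumes W: "finite W" and z: "z \<in> cycles W H" and "H \<subseteq> W \<times> W" and irr: "\<And>i. (i, i) \<notin> H"
    and nz: "z i j = 1"
  shows "6 \<le> card {(i, j) \<in> H. z i j = 1}"
proof -
  note sym = cyclesD(1)[OF z] and supp = cyclesD(2)[OF z] and row = cyclesD(3)[OF z]
  have ij: "i \<in> W" "j \<in> W" "i \<noteq> j" using supp[OF nz] assms by auto
  obtain k where k: "k \<in> W" "k \<noteq> j" "z i k = 1"
    using bit_sum_eq_0_obtain_other[OF W row] ij nz by metis
  have nz': "z j i = 1" using nz sym by simp
  obtain l where l: "l \<in> W" "l \<noteq> i" "z j l = 1"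
    using bit_sum_eq_0_obtain_other[OF W row] ij nz' by metis
  have "i \<noteq> k" "j \<noteq> l" using supp irr k(3) l(3) by metis+
  then have "card {(i, j), (j, i), (i, k), (k, i), (j, l), (l, j)} = 6"
    using ij k l by auto
  moreover have "{(i, j), (j, i), (i, k), (k, i), (j, l), (l, j)} \<subseteq> {(i, j) \<in> H. z i j = 1}"
    using nz nz' k(3) l(3) sym[of k i] sym[of l j] by (simp add: supp)
  moreover have "finite {(i, j) \<in> H. z i j = 1}"
  proof (rule finite_subset)
    show "{(i, j) \<in> H. z i j = 1} \<subseteq> W \<times> W" using \<open>H \<subseteq> W \<times> W\<close> by blast
  qed (simp add: W)
  ultimately show ?thesis by (simp only: card_mono flip: \<open>card _ = 6\<close>)
qed

text \<open>Summing the edges of a walk from u to v modulo 2 leaves odd degree exactly at u and v,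
  or nowhere if u = v.\<close>

lemma path_chain:
  assumes W: "finite W" and E: "E \<subseteq> W \<times> W" "sym E" and uv: "(u, v) \<in> E\<^sup>*"
  obtains c :: "'a \<Rightarrow> 'a \<Rightarrow> bit"
  where "\<And>p q. c p q = c q p" "\<And>p q. (p, q) \<notin> E \<Longrightarrow> c p q = 0"
    "\<And>p. p \<in> W \<Longrightarrow> (\<Sum>q\<in>W. c p q) = of_bool (p = u) + of_bool (p = v)"
proof -
  have "\<exists>c :: 'a \<Rightarrow> 'a \<Rightarrow> bit. (\<forall>p q. c p q = c q p) \<and> (\<forall>p q. (p, q) \<notin> E \<longrightarrow> c p q = 0) \<and>
     (\<forall>p\<in>W. (\<Sum>q\<in>W. c p q) = of_bool (p = u) + of_bool (p = v))"
    using uv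
  proof (induction rule: rtrancl_induct)
    case base
    then show ?case by (intro exI[of _ "\<lambda>_ _. 0"]) simp
  next
    case (step y z)
    then obtain c :: "'a \<Rightarrow> 'a \<Rightarrow> bit" where c: "\<And>p q. c p q = c q p" "\<And>p q. (p, q) \<notin> E \<Longrightarrow> c p q = 0"
     "\<And>p. p \<in> W \<Longrightarrow> (\<Sum>q\<in>W. c p q) = of_bool (p = u) + of_bool (p = y)"
      by blast
    have yz: "y \<in> W" "z \<in> W" "(z, y) \<in> E" using step E by (auto dest: symD)
    have s: "(\<Sum>q\<in>W. of_bool (p = a \<and> q = b)) = (of_bool (p = a) :: bit)" if "b \<in> W" for p a b
      using that W by (cases "p = a") (simp_all add: of_bool_def)
    show ?case
      by (intro exI[of _ "\<lambda>p q. c p q + (of_bool (p = y \<and> q = z) + of_bool (p = z \<and> q = y))"])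
        (use c step(2) yz in \<open>auto simp: sum.distrib s add_ac conj_commute\<close>)
  qed
  then show ?thesis using that by blast
qed

section \<open>Cycles of the grid are coboundaries\<close>

type_synonym pt = "int \<times> int"

definition grid :: "pt rel" where
  "grid = {(p, q). \<bar>fst p - fst q\<bar> + \<bar>snd p - snd q\<bar> = 1}"

lemma in_grid_iff:
  "((x, y), q) \<in> grid \<longleftrightarrow> q = (x + 1, y) \<or> q = (x - 1, y) \<or> q = (x, y + 1) \<or> q = (x, y - 1)"
  by (cases q) (auto simp: grid_def)

lemma grid_sym: "(p, q) \<in> grid \<longleftrightarrow> (q, p) \<in> grid"
  by (auto simp: grid_def)

text \<open>
  The unit square to the left of the directed edge from p to q, named by its lower left corner; the
  square on the right is \<open>left q p\<close>. The value is meaningful only for neighbours p and q.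
\<close>

fun left :: "pt \<Rightarrow> pt \<Rightarrow> pt" where
  "left (x, y) (x', y') =
     (if y < y' then (x - 1, y) else if x < x' then (x, y) else if y' < y then (x, y - 1)
      else (x - 1, y - 1))"

text \<open>An edge is selected when \<open>f\<close> differs on the two squares beside it: this is
  the coboundary in the dual grid, whose vertices are the squares.\<close>

definition coboundary :: "(pt \<Rightarrow> bit) \<Rightarrow> pt \<Rightarrow> pt \<Rightarrow> bit" where
  "coboundary f p q = (if (p, q) \<in> grid then f (left p q) + f (left q p) else 0)"

lemma coboundary_sym: "coboundary f p q = coboundary f q p"
  by (simp add: coboundary_def grid_sym add.commute)

lemma sum_grid_neighbours:
  fixes g :: "pt \<Rightarrow> bit"
  assumes W: "finite W" and supp: "\<And>q. ((x, y), q) \<notin> grid \<or> q \<notin> W \<Longrightarrow> g q = 0"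
  shows "(\<Sum>q\<in>W. g q) = g (x + 1, y) + g (x - 1, y) + g (x, y + 1) + g (x, y - 1)"
proof -
  let ?N = "{(x + 1, y), (x - 1, y), (x, y + 1), (x, y - 1)}"
  have "(\<Sum>q\<in>W. g q) = (\<Sum>q\<in>W \<union> ?N. g q)"
    by (rule sum.mono_neutral_left) (use W supp in auto)
  also have "\<dots> = (\<Sum>q\<in>?N. g q)"
    by (rule sum.mono_neutral_right) (use W supp in \<open>auto simp: in_grid_iff\<close>)
  finally show ?thesis by (simp add: add_ac)
qed

text \<open>Each of the four squares around a lattice point lies beside two of the four edges there,
  so its value occurs twice in the degree sum and cancels.\<close>

lemma coboundary_in_cycles:
  assumes W: "finite W" and H: "H \<subseteq> W \<times> W"
    and supp: "\<And>p q. (p, q) \<in> grid \<Longrightarrow> (p, q) \<notin> H \<Longrightarrow> f (left p q) = f (left q p)"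
  shows "coboundary f \<in> cycles W H"
proof -
  have 0: "coboundary f p q = 0" if "(p, q) \<notin> H" for p q
    using supp[of p q] that by (simp add: coboundary_def)
  have "(\<Sum>q\<in>W. coboundary f p q) = 0" for p
  proof (cases p)
    case (Pair x y)
    have "(\<Sum>q\<in>W. coboundary f (x, y) q) =
       coboundary f (x, y) (x + 1, y) + coboundary f (x, y) (x - 1, y) +
       coboundary f (x, y) (x, y + 1) + coboundary f (x, y) (x, y - 1)"
    proof (rule sum_grid_neighbours[OF W])
      fix q assume "((x, y), q) \<notin> grid \<or> q \<notin> W"
      then show "coboundary f (x, y) q = 0"
        using 0 H coboundary_def[of f "(x, y)" q] by (metis mem_Sigma_iff subsetD)
    qed
    also have "\<dots> = 0"
      by (simp add: coboundary_def in_grid_iff add_ac)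
    finally show ?thesis using Pair by simp
  qed
  with 0 coboundary_sym show ?thesis by (auto simp: cycles_def)
qed

text \<open>The function constructed here jumps correctly across vertical edges by definition. For
  horizontal edges the claim spreads to the right, column by column, because all degrees are
  even.\<close>

lemma cycle_is_coboundary:
  assumes W: "finite W" and c: "c \<in> cycles W H" and H: "H \<subseteq> grid \<inter> W \<times> W"
  obtains f where "coboundary f = c"
proof -
  note sym = cyclesD(1)[OF c] and row = cyclesD(3)[OF c]
  have supp: "(p, q) \<notin> H \<Longrightarrow> c p q = 0" for p q
    using cyclesD(2)[OF c] by (metis bit_not_one_iff)
  have even: "c (x, y) (x + 1, y) + c (x, y) (x - 1, y) + c (x, y) (x, y + 1) + c (x, y) (x, y - 1) = 0"
    for x y
  proof (cases "(x, y) \<in> W")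
    case True
    have "(\<Sum>q\<in>W. c (x, y) q) =
      c (x, y) (x + 1, y) + c (x, y) (x - 1, y) + c (x, y) (x, y + 1) + c (x, y) (x, y - 1)"
    proof (rule sum_grid_neighbours[OF W])
      fix q assume "((x, y), q) \<notin> grid \<or> q \<notin> W"
      then show "c (x, y) q = 0" using H supp by blast
    qed
    with row True show ?thesis by simp
  next
    case False
    then have "c (x, y) q = 0" for q using H supp by blast
    then show ?thesis by simp
  qed
  \<comment> \<open>The columns up to \<open>N\<close> miss \<open>W\<close>, so rays may stop
    there, and the induction for horizontal edges starts there with zeros.\<close>
  obtain N where N: "\<And>x y. (x, y) \<in> W \<Longrightarrow> N < x"
  proof
    fix x y assume "(x, y) \<in> W"
    then have "Min (insert 0 (fst ` W)) \<le> x" using W by (intro Min_le) force+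
    then show "Min (insert 0 (fst ` W)) - 1 < x" by simp
  qed
  have out: "c (x, y) q = 0" if "x \<le> N" for x y q
  proof -
    have "(x, y) \<notin> W" using N[of x y] that by auto
    then show ?thesis using H supp by blast
  qed
  \<comment> \<open>The winding number modulo 2: count the edges met by a ray going left from the square.\<close>
  define f where "f = (\<lambda>(x, y). \<Sum>k\<in>{N<..x}. c (k, y) (k, y + 1))"
  have fN: "f (x, y) = 0" if "x \<le> N" for x y
    using that by (simp add: f_def)
  have vert: "f (x, y) = f (x - 1, y) + c (x, y) (x, y + 1)" for x y
  proof (cases "x \<le> N")
    case True then show ?thesis by (simp add: fN out)
  next
    case False
    then have "{N<..x} = insert x {N<..x - 1}" by auto
    then show ?thesis by (simp add: f_def add.commute)
  qed
  have hor: "f (x, y) + f (x, y - 1) = c (x, y) (x + 1, y)" for x y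
  proof (cases "x \<le> N")
    case True then show ?thesis by (simp add: fN out)
  next
    case False
    then have "N \<le> x" by simp
    then show ?thesis
    proof (induction x rule: int_ge_induct)
      case base then show ?case by (simp add: fN out)
    next
      case (step x)
      have "f (x + 1, y) + f (x + 1, y - 1) =
          (f (x, y) + f (x, y - 1)) + c (x + 1, y) (x + 1, y + 1) + c (x + 1, y - 1) (x + 1, y)"
        using vert[of "x + 1" y] vert[of "x + 1" "y - 1"] by (simp add: add_ac)
      also have "\<dots> = c (x + 1, y) (x, y) + c (x + 1, y) (x + 1, y + 1) + c (x + 1, y) (x + 1, y - 1)"
        using step.IH sym by metis
      \<comment> \<open>The even degree at (x + 1, y) trades the edges to the left, up and down for
        the edge to the right.\<close>
      also have "\<dots> = c (x + 1, y) (x + 1 + 1, y)"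
        using even[of "x + 1" y] by (simp only: add_diff_cancel_right' bit_add_eq_0_iff add.assoc)
      finally show ?case .
    qed
  qed
  have up: "coboundary f (x, y) (x, y + 1) = c (x, y) (x, y + 1)" for x y
    by (simp add: coboundary_def in_grid_iff vert[of x y] add_ac)
  have right: "coboundary f (x, y) (x + 1, y) = c (x, y) (x + 1, y)" for x y
    by (simp add: coboundary_def in_grid_iff hor)
  have "coboundary f p q = c p q" for p q
  proof (cases "(p, q) \<in> grid")
    case True
    obtain x y where p: "p = (x, y)" by (cases p)
    show ?thesis using True up[of x y] up[of x "y - 1"] right[of x y] right[of "x - 1" y]
      unfolding p in_grid_iff
      by (elim disjE) (simp_all, metis coboundary_sym sym, metis coboundary_sym sym)
  next
    case False
    then have "c p q = 0" using supp H by blast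
    with False show ?thesis by (simp add: coboundary_def)
  qed
  then show ?thesis using that by blast
qed

text \<open>Adjacent squares share an edge, and the dual grid is connected.\<close>

lemma coboundary_eq_0_imp_const:
  assumes "\<And>p q. coboundary f p q = 0"
  shows "f F = f F'"
proof -
  have e: "f (left p q) = f (left q p)" if "(p, q) \<in> grid" for p q
    using assms[of p q] that by (simp add: coboundary_def bit_add_eq_0_iff)
  have x: "f (x, y) = f (x + 1, y)" and y: "f (x, y) = f (x, y + 1)" for x y
    using e[of "(x + 1, y)" "(x + 1, y + 1)"] e[of "(x, y + 1)" "(x + 1, y + 1)"]
    unfolding in_grid_iff by auto
  have X: "f (x, y) = f (0, y)" for x y
  proof (induction x rule: int_induct[of _ 0])
    case (step1 i) then show ?case by (simp only: x[of i y, symmetric])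
  next
    case (step2 i) then show ?case using x[of "i - 1" y] by simp
  qed simp
  have Y: "f (0, y) = f (0, 0)" for y
  proof (induction y rule: int_induct[of _ 0])
    case (step1 i) then show ?case by (simp only: y[of 0 i, symmetric])
  next
    case (step2 i) then show ?case using y[of 0 "i - 1"] by simp
  qed simp
  show ?thesis using X Y by (metis surj_pair)
qed

section \<open>Complete minors\<close>

definition complete_rel :: "nat \<Rightarrow> nat rel" where
  "complete_rel n = {(i, j). i < n \<and> j < n \<and> i \<noteq> j}"

text \<open>The edges that avoid 0 form the complement of the spanning star at 0, and each lies in
  exactly one triangle through 0. So the coefficients of the triangles can be read off from these
  edges; for n = 5 there are 6 of them.\<close>

lemma complete_rel_cycle_extends:
  fixes g :: "nat \<times> nat \<Rightarrow> bit"
  obtains z where "z \<in> cycles {..<n} (complete_rel n)"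
    "\<And>k l. 0 < k \<Longrightarrow> k < l \<Longrightarrow> l < n \<Longrightarrow> z k l = g (k, l)"
proof
  define P where "P = {(k, l). 0 < k \<and> k < l \<and> l < n}"
  have "P \<subseteq> {..<n} \<times> {..<n}" by (auto simp: P_def)
  then have finP: "finite P" by (rule finite_subset) simp
  \<comment> \<open>The triangles through the vertex 0 form a basis of the cycle space.\<close>
  define tri :: "nat \<times> nat \<Rightarrow> nat \<Rightarrow> nat \<Rightarrow> bit"
    where "tri = (\<lambda>(k, l) i j. of_bool (i \<noteq> j \<and> i \<in> {0, k, l} \<and> j \<in> {0, k, l}))"
  define z where "z = (\<lambda>i j. \<Sum>e\<in>P. g e * tri e i j)"
  have "(\<Sum>j<n. tri e i j) = 0" if eP: "e \<in> P" for e i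
  proof -
    obtain k l where e: "e = (k, l)" "0 < k" "k < l" "l < n" using eP by (auto simp: P_def)
    have "(\<Sum>j<n. tri e i j) = (\<Sum>j\<in>{0, k, l}. tri e i j)"
      by (rule sum.mono_neutral_right) (use e in \<open>auto simp: tri_def\<close>)
    also have "\<dots> = tri e i 0 + (tri e i k + tri e i l)" using e by simp
    also have "\<dots> = 0" using e by (auto simp: tri_def)
    finally show ?thesis .
  qed
  then have "(\<Sum>j<n. z i j) = 0" for i
    unfolding z_def by (subst sum.swap) (simp add: sum_distrib_left[symmetric])
  moreover have "z i j = z j i" for i j
    unfolding z_def by (intro sum.cong refl) (auto simp: tri_def split: prod.splits)
  moreover have "z i j = 0" if "(i, j) \<notin> complete_rel n" for i j
    unfolding z_def
    by (intro sum.neutral) (use that in \<open>auto simp: tri_def P_def complete_rel_def\<close>)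
  ultimately show "z \<in> cycles {..<n} (complete_rel n)"
    by (auto simp: cycles_def)
  fix k l :: nat assume kl: "0 < k" "k < l" "l < n"
  have "z k l = (\<Sum>e\<in>P. if e = (k, l) then g e else 0)"
    unfolding z_def by (intro sum.cong refl) (use kl in \<open>auto simp: tri_def P_def\<close>)
  also have "\<dots> = g (k, l)" using kl finP by (simp add: P_def)
  finally show "z k l = g (k, l)" .
qed

text \<open>
  V i and E i are the vertices and edges of the branch sets, and \<open>a i j\<close> is the end in V i of the edge
  that joins V i to V j.
\<close>

locale complete_minor =
  fixes n :: nat and V :: "nat \<Rightarrow> 'a set" and E :: "nat \<Rightarrow> 'a rel" and a :: "nat \<Rightarrow> nat \<Rightarrow> 'a"
  assumes fin: "\<And>i. i < n \<Longrightarrow> finite (V i)"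
    and disj: "\<And>i j p. i < n \<Longrightarrow> j < n \<Longrightarrow> p \<in> V i \<Longrightarrow> p \<in> V j \<Longrightarrow> i = j"
    and E_sub: "\<And>i. i < n \<Longrightarrow> E i \<subseteq> V i \<times> V i"
    and E_sym: "\<And>i. i < n \<Longrightarrow> sym (E i)"
    and E_irrefl: "\<And>i p. i < n \<Longrightarrow> (p, p) \<notin> E i"
    and conn: "\<And>i p q. i < n \<Longrightarrow> p \<in> V i \<Longrightarrow> q \<in> V i \<Longrightarrow> (p, q) \<in> (E i)\<^sup>*"
    and a: "\<And>i j. (i, j) \<in> complete_rel n \<Longrightarrow> a i j \<in> V i"
begin

definition W :: "'a set" where
  "W = (\<Union>i<n. V i)"

definition H0 :: "'a rel" where
  "H0 = (\<Union>i<n. E i) \<union> (\<lambda>(i, j). (a i j, a j i)) ` complete_rel n"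

text \<open>Each branch set shrinks to a point: only the values on the chosen connecting edges
  survive.\<close>

definition contract :: "('a \<Rightarrow> 'a \<Rightarrow> bit) \<Rightarrow> nat \<Rightarrow> nat \<Rightarrow> bit" where
  "contract c i j = (if (i, j) \<in> complete_rel n then c (a i j) (a j i) else 0)"

lemma complete_rel_sym: "(i, j) \<in> complete_rel n \<Longrightarrow> (j, i) \<in> complete_rel n"
  by (auto simp: complete_rel_def)

lemma finite_complete_rel: "finite (complete_rel n)"
  by (rule finite_subset[of _ "{..<n} \<times> {..<n}"]) (auto simp: complete_rel_def)

lemma finite_W: "finite W"
  using fin by (auto simp: W_def)

lemma a_in_W: "(i, j) \<in> complete_rel n \<Longrightarrow> a i j \<in> W"
  using a by (fastforce simp: W_def complete_rel_def)

lemma H0_sub: "H0 \<subseteq> W \<times> W"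
  using E_sub a_in_W complete_rel_sym by (fastforce simp: H0_def W_def)

text \<open>An end determines its branch set by disjointness. Hence the two ends of a connecting
  edge determine the pair (i, j).\<close>

lemma a_eqD:
  assumes "(i, j) \<in> complete_rel n" "(i', j') \<in> complete_rel n" "a i j = a i' j'"
  shows "i = i'"
  using a[OF assms(1)] a[OF assms(2)] assms by (auto simp: complete_rel_def intro: disj)

lemma H0_sym: "sym H0"
proof (rule symI)
  fix p q assume "(p, q) \<in> H0"
  then show "(q, p) \<in> H0"
    using E_sym complete_rel_sym by (fastforce simp: H0_def dest: symD)
qed

lemma H0_irrefl: "(p, p) \<notin> H0"
proof
  assume "(p, p) \<in> H0"
  then obtain i j where "(i, j) \<in> complete_rel n" "a i j = a j i"
    using E_irrefl by (auto simp: H0_def)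
  then show False
    using a_eqD[of i j j i] complete_rel_sym by (auto simp: complete_rel_def)
qed

text \<open>Summed over \<open>V i\<close>, the even degrees of \<open>c\<close> count the edges
  inside \<open>V i\<close> twice. What remains are the edges leaving \<open>V i\<close>, and in
  \<open>H0\<close> these are the connecting edges at i.\<close>

lemma contract_in_cycles:
  assumes c: "c \<in> cycles W H0"
  shows "contract c \<in> cycles {..<n} (complete_rel n)"
proof -
  note sym = cyclesD(1)[OF c] and row = cyclesD(3)[OF c]
  have supp: "c p q = 0" if "(p, q) \<notin> H0" for p q
    using cyclesD(2)[OF c] that by (metis bit_not_one_iff)
  have "(\<Sum>j<n. contract c i j) = 0" if i: "i < n" for i
  proof -
    have Vi: "V i \<subseteq> W" using i by (auto simp: W_def)
    let ?J = "{..<n} - {i}"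
    have J: "j \<in> ?J \<Longrightarrow> (i, j) \<in> complete_rel n" for j using i by (auto simp: complete_rel_def)
    have inj: "inj_on (\<lambda>j. (a i j, a j i)) ?J"
      using a_eqD J complete_rel_sym by (intro inj_onI) blast
    have "(\<Sum>p\<in>V i. \<Sum>q\<in>W - V i. c p q) = (\<Sum>(p, q)\<in>V i \<times> (W - V i). c p q)"
      by (rule sum.cartesian_product)
    also have "\<dots> = (\<Sum>(p, q)\<in>(\<lambda>j. (a i j, a j i)) ` ?J. c p q)"
    proof (rule sum.mono_neutral_right)
      show "finite (V i \<times> (W - V i))" using fin[OF i] finite_W by simp
      show "(\<lambda>j. (a i j, a j i)) ` ?J \<subseteq> V i \<times> (W - V i)"
      proof (rule image_subsetI)
        fix j assume j: "j \<in> ?J"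
        then have ij: "(i, j) \<in> complete_rel n" using J by simp
        have "a i j \<in> V i" "a j i \<in> W" using a a_in_W ij complete_rel_sym by blast+
        moreover have "a j i \<notin> V i"
          using disj[of i j "a j i"] a[of j i] ij complete_rel_sym i j by blast
        ultimately show "(a i j, a j i) \<in> V i \<times> (W - V i)" by blast
      qed
      have zero: "c p q = 0" if pq: "p \<in> V i" "q \<notin> V i" "(p, q) \<notin> (\<lambda>j. (a i j, a j i)) ` ?J" for p q
      proof (rule supp, rule notI)
        assume "(p, q) \<in> H0"
        then consider k where "k < n" "(p, q) \<in> E k"
          | k l where "(k, l) \<in> complete_rel n" "p = a k l" "q = a l k"
          by (auto simp: H0_def)
        then show False
        proof cases
          case 1
          then have "p \<in> V k" "q \<in> V k" using E_sub by blast+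
          then show False using disj[of i k p] i 1 pq by blast
        next
          case 2
          then have "p \<in> V k" using a by blast
          then have "i = k" using disj[of i k p] i 2 pq by (auto simp: complete_rel_def)
          then show False using 2 pq by (auto simp: complete_rel_def)
        qed
      qed
      show "\<forall>x\<in>V i \<times> (W - V i) - (\<lambda>j. (a i j, a j i)) ` ?J. (case x of (p, q) \<Rightarrow> c p q) = 0"
      proof
        fix x assume x: "x \<in> V i \<times> (W - V i) - (\<lambda>j. (a i j, a j i)) ` ?J"
        show "(case x of (p, q) \<Rightarrow> c p q) = 0"
          using x zero[of "fst x" "snd x"] by (cases x) simp
      qed
    qed
    also have "\<dots> = (\<Sum>j\<in>?J. c (a i j) (a j i))"
      by (simp add: sum.reindex[OF inj])
    also have "\<dots> = (\<Sum>j\<in>?J. contract c i j)"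
      using J by (simp add: contract_def)
    also have "\<dots> = (\<Sum>j<n. contract c i j)"
      by (rule sum.mono_neutral_left) (use i in \<open>auto simp: contract_def complete_rel_def\<close>)
    finally have "(\<Sum>j<n. contract c i j) = (\<Sum>p\<in>V i. \<Sum>q\<in>W - V i. c p q)" ..
    \<comment> \<open>The added inner sum is 0 by symmetry; it completes every degree sum to all of
      \<open>W\<close>.\<close>
    also have "\<dots> = (\<Sum>p\<in>V i. \<Sum>q\<in>W - V i. c p q) + (\<Sum>p\<in>V i. \<Sum>q\<in>V i. c p q)"
      using sum_sym_eq_0[of "V i" c] fin[OF i] sym supp H0_irrefl by simp
    also have "\<dots> = (\<Sum>p\<in>V i. \<Sum>q\<in>W. c p q)"
      by (simp add: sum.subset_diff[OF Vi finite_W] sum.distrib)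
    also have "\<dots> = 0"
      using Vi row by (intro sum.neutral) blast
    finally show ?thesis .
  qed
  moreover have "contract c i j = contract c j i" for i j
    using complete_rel_sym sym by (auto simp: contract_def)
  ultimately show ?thesis
    by (auto simp: cycles_def contract_def)
qed

text \<open>An edge ij lifts to its connecting edge, prolonged inside both branch sets by paths to
  fixed roots. The degree at the root of \<open>V i\<close> is then that of i in \<open>z\<close>,
  modulo 2, hence even.\<close>

lemma lift_cycle:
  assumes z: "z \<in> cycles {..<n} (complete_rel n)"
  obtains c where "c \<in> cycles W H0" "contract c = z"
proof -
  note z_sym = cyclesD(1)[OF z] and z_row = cyclesD(3)[OF z]
  have z_supp: "z i j = 0" if "(i, j) \<notin> complete_rel n" for i j
    using cyclesD(2)[OF z] that by (metis bit_not_one_iff)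
  \<comment> \<open>The root is used only if i occurs in a pair of \<open>complete_rel n\<close>;
    then \<open>a i j\<close> witnesses that \<open>V i\<close> is nonempty.\<close>
  define r where "r i = (SOME p. p \<in> V i)" for i
  have "\<exists>\<pi> :: 'a \<Rightarrow> 'a \<Rightarrow> bit. (\<forall>p q. \<pi> p q = \<pi> q p) \<and> (\<forall>p q. (p, q) \<notin> E i \<longrightarrow> \<pi> p q = 0) \<and>
      (\<forall>p\<in>W. (\<Sum>q\<in>W. \<pi> p q) = of_bool (p = r i) + of_bool (p = a i j))"
    if ij: "(i, j) \<in> complete_rel n" for i j
  proof -
    have i: "i < n" using ij by (simp add: complete_rel_def)
    have "r i \<in> V i" unfolding r_def using a[OF ij] by (rule someI)
    then have "(r i, a i j) \<in> (E i)\<^sup>*" using conn i a[OF ij] by blast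
    moreover have "E i \<subseteq> W \<times> W" using E_sub[OF i] i by (auto simp: W_def)
    ultimately obtain \<pi> :: "'a \<Rightarrow> 'a \<Rightarrow> bit" where "\<And>p q. \<pi> p q = \<pi> q p"
      "\<And>p q. (p, q) \<notin> E i \<Longrightarrow> \<pi> p q = 0"
      "\<And>p. p \<in> W \<Longrightarrow> (\<Sum>q\<in>W. \<pi> p q) = of_bool (p = r i) + of_bool (p = a i j)"
      using path_chain[OF finite_W _ E_sym[OF i]] by blast
    then show ?thesis by (intro exI[of _ \<pi>]) blast
  qed
  then obtain \<pi> :: "nat \<Rightarrow> nat \<Rightarrow> 'a \<Rightarrow> 'a \<Rightarrow> bit"
    where pi_sym: "\<And>i j p q. (i, j) \<in> complete_rel n \<Longrightarrow> \<pi> i j p q = \<pi> i j q p"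
      and pi_supp: "\<And>i j p q. (i, j) \<in> complete_rel n \<Longrightarrow> (p, q) \<notin> E i \<Longrightarrow> \<pi> i j p q = 0"
      and pi_sum: "\<And>i j p. (i, j) \<in> complete_rel n \<Longrightarrow> p \<in> W \<Longrightarrow>
        (\<Sum>q\<in>W. \<pi> i j p q) = of_bool (p = r i) + of_bool (p = a i j)"
    by metis
  \<comment> \<open>One direction only: the sum over ordered pairs supplies the other.\<close>
  define \<epsilon> :: "nat \<Rightarrow> nat \<Rightarrow> 'a \<Rightarrow> 'a \<Rightarrow> bit"
    where "\<epsilon> i j p q = of_bool (p = a i j \<and> q = a j i)" for i j p q
  define c where "c p q = (\<Sum>i<n. \<Sum>j<n. z i j * (\<pi> i j p q + \<epsilon> i j p q))" for p q
  \<comment> \<open>Summands may be rewritten for pairs in \<open>complete_rel n\<close> only, since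
    \<open>z\<close> vanishes elsewhere.\<close>
  have nz: "z i j * x = z i j * y" if "(i, j) \<in> complete_rel n \<Longrightarrow> x = y" for i j x y
    using that z_supp by (cases "(i, j) \<in> complete_rel n") auto
  have "c p q = c q p" for p q
  proof -
    have "c p q = (\<Sum>i<n. \<Sum>j<n. z i j * \<pi> i j p q) + (\<Sum>i<n. \<Sum>j<n. z i j * \<epsilon> i j p q)"
      by (simp add: c_def distrib_left sum.distrib)
    also have "(\<Sum>i<n. \<Sum>j<n. z i j * \<pi> i j p q) = (\<Sum>i<n. \<Sum>j<n. z i j * \<pi> i j q p)"
      using pi_sym by (intro sum.cong refl nz)
    also have "(\<Sum>i<n. \<Sum>j<n. z i j * \<epsilon> i j p q) = (\<Sum>j<n. \<Sum>i<n. z i j * \<epsilon> i j p q)"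
      by (rule sum.swap)
    also have "\<dots> = (\<Sum>i<n. \<Sum>j<n. z i j * \<epsilon> i j q p)"
      by (intro sum.cong refl) (simp add: \<epsilon>_def z_sym conj_commute)
    finally show ?thesis by (simp add: c_def distrib_left sum.distrib)
  qed
  moreover have "c p q = 0" if pq: "(p, q) \<notin> H0" for p q
  proof -
    have "z i j * (\<pi> i j p q + \<epsilon> i j p q) = z i j * 0" for i j
    proof (rule nz)
      assume ij: "(i, j) \<in> complete_rel n"
      then have "(p, q) \<notin> E i" "\<not> (p = a i j \<and> q = a j i)"
        using pq by (auto simp: H0_def complete_rel_def)
      then show "\<pi> i j p q + \<epsilon> i j p q = 0"
        using pi_supp[OF ij] by (simp add: \<epsilon>_def)
    qed
    then show ?thesis by (simp only: c_def mult_zero_right sum.neutral_const)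
  qed
  moreover have "(\<Sum>q\<in>W. c p q) = 0" if p: "p \<in> W" for p
  proof -
    have "(\<Sum>q\<in>W. c p q) = (\<Sum>i<n. \<Sum>j<n. z i j * (\<Sum>q\<in>W. \<pi> i j p q + \<epsilon> i j p q))"
      unfolding c_def sum_distrib_left
      by (subst sum.swap, intro sum.cong refl, subst sum.swap) simp
    \<comment> \<open>The end of the path at \<open>a i j\<close> cancels against the connecting
      edge, and only the root remains.\<close>
    also have "\<dots> = (\<Sum>i<n. \<Sum>j<n. z i j * of_bool (p = r i))"
    proof (intro sum.cong refl nz)
      fix i j assume ij: "(i, j) \<in> complete_rel n"
      have "(\<Sum>q\<in>W. \<epsilon> i j p q) = of_bool (p = a i j)"
        using a_in_W[OF complete_rel_sym[OF ij]] finite_W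
        by (cases "p = a i j") (simp_all add: \<epsilon>_def of_bool_def)
      then show "(\<Sum>q\<in>W. \<pi> i j p q + \<epsilon> i j p q) = of_bool (p = r i)"
        using pi_sum[OF ij p] by (simp add: sum.distrib add.assoc)
    qed
    also have "\<dots> = 0"
      using z_row by (simp add: sum_distrib_right[symmetric])
    finally show ?thesis .
  qed
  ultimately have "c \<in> cycles W H0" unfolding cycles_def by blast
  moreover have "contract c = z"
  proof (intro ext)
    fix i j
    show "contract c i j = z i j"
    proof (cases "(i, j) \<in> complete_rel n")
      case True
      \<comment> \<open>Paths stay inside branch sets and different pairs have different connecting
        arcs, so only the summand of (i, j) counts.\<close>
      have "c (a i j) (a j i) = (\<Sum>i'<n. \<Sum>j'<n. z i' j' * of_bool (i' = i \<and> j' = j))"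
        unfolding c_def
      proof (intro sum.cong refl nz)
        fix i' j' assume ij': "(i', j') \<in> complete_rel n"
        have "(a i j, a j i) \<notin> E i'"
        proof
          assume "(a i j, a j i) \<in> E i'"
          then have "a i j \<in> V i'" "a j i \<in> V i'"
            using E_sub ij' by (auto simp: complete_rel_def)
          then have "i = i'" "j = i'"
            using disj[of i i' "a i j"] disj[of j i' "a j i"] a[OF True] a[OF complete_rel_sym[OF True]]
              True ij' by (simp_all add: complete_rel_def)
          then show False using True by (simp add: complete_rel_def)
        qed
        moreover have "a i j = a i' j' \<and> a j i = a j' i' \<longleftrightarrow> i' = i \<and> j' = j"
          using a_eqD[OF True ij'] a_eqD[OF complete_rel_sym[OF True] complete_rel_sym[OF ij']]
          by auto
        ultimately show "\<pi> i' j' (a i j) (a j i) + \<epsilon> i' j' (a i j) (a j i) = of_bool (i' = i \<and> j' = j)"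
          using pi_supp[OF ij'] by (simp add: \<epsilon>_def)
      qed
      also have "\<dots> = (\<Sum>i'<n. \<Sum>j'<n. if j' = j then if i' = i then z i j else 0 else 0)"
        by (intro sum.cong refl) auto
      also have "\<dots> = z i j"
        using True by (simp add: complete_rel_def)
      finally show ?thesis using True by (simp add: contract_def)
    qed (simp add: contract_def z_supp)
  qed
  ultimately show ?thesis using that by blast
qed

text \<open>
  A nonzero cycle c0 of H that contracts to 0 could be added to the lifts that use a given edge of
  c0, so this edge could be removed from H.
\<close>

lemma minimal_lifting:
  obtains H where "H \<subseteq> H0" "sym H"
    "\<And>z. z \<in> cycles {..<n} (complete_rel n) \<Longrightarrow> \<exists>c\<in>cycles W H. contract c = z"
    "\<And>c p q. c \<in> cycles W H \<Longrightarrow> (\<And>i j. contract c i j = 0) \<Longrightarrow> c p q = 0"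
proof -
  define lifts where "lifts H \<longleftrightarrow> H \<subseteq> H0 \<and> sym H \<and>
    (\<forall>z\<in>cycles {..<n} (complete_rel n). \<exists>c\<in>cycles W H. contract c = z)" for H
  have "lifts H0" using H0_sym lift_cycle by (metis lifts_def order_refl)
  then obtain H where H: "lifts H" and min: "\<And>H'. lifts H' \<Longrightarrow> card H \<le> card H'"
    using ex_has_least_nat[of lifts H0 card] by blast
  have H_H0: "H \<subseteq> H0" "sym H" using H by (auto simp: lifts_def)
  have "c0 u v = 0" if c0: "c0 \<in> cycles W H" and contr: "\<And>i j. contract c0 i j = 0" for c0 u v
  proof (rule ccontr)
    assume "c0 u v \<noteq> 0"
    then have uv: "c0 u v = 1" "(u, v) \<in> H" using cyclesD(2)[OF c0] by auto
    let ?H = "H - {(u, v), (v, u)}"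
    have "lifts ?H"
      unfolding lifts_def
    proof (intro conjI ballI)
      show "?H \<subseteq> H0" "sym ?H" using H_H0 by (auto simp: sym_def)
      fix z assume "z \<in> cycles {..<n} (complete_rel n)"
      then obtain c where c: "c \<in> cycles W H" "contract c = z" using H by (auto simp: lifts_def)
      define d where "d = (\<lambda>p q. c p q + c u v * c0 p q)"
      have d: "d \<in> cycles W H"
        using cycles_add[OF c(1) c0] c(1) by (cases "c u v") (simp_all add: d_def)
      have "d u v = 0" "d v u = 0" using uv cyclesD(1)[OF c(1)] cyclesD(1)[OF c0] by (simp_all add: d_def)
      then have "d \<in> cycles W ?H" using d by (auto simp: cycles_def)
      moreover have "contract d = z"
      proof (intro ext)
        fix i j
        have "contract d i j = contract c i j + c u v * contract c0 i j"
          by (simp add: contract_def d_def)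
        then show "contract d i j = z i j" using c(2) contr by simp
      qed
      ultimately show "\<exists>c\<in>cycles W ?H. contract c = z" by blast
    qed
    then have "card H \<le> card ?H" by (rule min)
    moreover have "finite H" using H_H0 H0_sub finite_W by (meson finite_SigmaI finite_subset)
    then have "card ?H < card H" using uv by (intro psubset_card_mono) auto
    ultimately show False by simp
  qed
  then show ?thesis using that[of H] H by (auto simp: lifts_def)
qed

end

section \<open>Regions of the grid\<close>

locale complete_minor_in_grid = complete_minor n V E a
  for n and V :: "nat \<Rightarrow> pt set" and E a +
  assumes E_grid: "\<And>i. i < n \<Longrightarrow> E i \<subseteq> grid"
    and a_grid: "\<And>i j. (i, j) \<in> complete_rel n \<Longrightarrow> (a i j, a j i) \<in> grid"
begin

lemma H0_grid: "H0 \<subseteq> grid"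
  using E_grid a_grid by (fastforce simp: H0_def)

text \<open>\<open>reg F\<close> is the region of the square F; the case of infinitely many regions need not be excluded.\<close>

lemma regions_lower_bound:
  "\<exists>reg :: pt \<Rightarrow> pt set.
     (infinite (range reg) \<or> Suc (card {(k, l). 0 < k \<and> k < l \<and> l < n}) \<le> card (range reg)) \<and>
     (\<forall>F. range reg \<noteq> {reg F} \<longrightarrow>
       (\<exists>z\<in>cycles {..<n} (complete_rel n). (\<exists>i j. z i j = 1) \<and>
         (\<forall>i j. z i j = 1 \<longrightarrow> reg F \<in> {reg (left (a i j) (a j i)), reg (left (a j i) (a i j))})))"
proof -
  obtain H where H: "H \<subseteq> H0" "sym H"
    and lift: "\<And>z. z \<in> cycles {..<n} (complete_rel n) \<Longrightarrow> \<exists>c\<in>cycles W H. contract c = z"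
    and faithful: "\<And>c p q. c \<in> cycles W H \<Longrightarrow> (\<And>i j. contract c i j = 0) \<Longrightarrow> c p q = 0"
    using minimal_lifting by blast
  have HW: "H \<subseteq> grid \<inter> W \<times> W" "H \<subseteq> W \<times> W" using H H0_grid H0_sub by auto
  \<comment> \<open>Two squares are joined when the edge between them is not in \<open>H\<close>;
    the regions are the connected components of this relation.\<close>
  define r where "r = {(left p q, left q p) |p q. (p, q) \<in> grid - H}"
  define reg where "reg F = r\<^sup>* `` {F}" for F
  have "sym r"
  proof (rule symI)
    fix F F' assume "(F, F') \<in> r"
    then obtain p q where "F = left p q" "F' = left q p" "(p, q) \<in> grid - H"
      unfolding r_def by blast
    moreover have "(q, p) \<in> grid - H" if "(p, q) \<in> grid - H" for p q
      using that grid_sym symD[OF H(2)] by blast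
    ultimately show "(F', F) \<in> r" unfolding r_def by blast
  qed
  then have symr: "sym (r\<^sup>*)" by (rule sym_rtrancl)
  have reg_self: "F \<in> reg F" for F by (simp add: reg_def)
  have reg_eq: "F' \<in> reg F \<longleftrightarrow> reg F' = reg F" for F F'
  proof
    assume "F' \<in> reg F"
    then have "(F, F') \<in> r\<^sup>*" "(F', F) \<in> r\<^sup>*" using symr by (auto simp: reg_def dest: symD)
    then show "reg F' = reg F" by (auto simp: reg_def intro: rtrancl_trans)
  qed (use reg_self in blast)
  define dim where "dim = card {(k, l). 0 < k \<and> k < l \<and> l < n}"
  have card: "Suc dim \<le> card (range reg)" if fin: "finite (range reg)"
  proof -
    define P where "P = {(k, l). 0 < k \<and> k < l \<and> l < n}"
    \<comment> \<open>The index (0, 0), which is not in \<open>P\<close>, stands for the additive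
      constant that a coboundary leaves open. It is fixed by the value of \<open>f\<close> on the
      square (0, 0).\<close>
    define Q where "Q = insert (0, 0) P"
    have "P \<subseteq> {..<n} \<times> {..<n}" by (auto simp: P_def)
    then have finP: "finite P" by (rule finite_subset) simp
    then have cardQ: "finite Q" "card Q = Suc dim" by (auto simp: Q_def P_def dim_def)
    have "\<exists>f. coboundary f \<in> cycles W H \<and> f (0, 0) = g (0, 0) \<and>
        (\<forall>(k, l)\<in>P. contract (coboundary f) k l = g (k, l))" for g :: "nat \<times> nat \<Rightarrow> bit"
    proof -
      obtain z where z: "z \<in> cycles {..<n} (complete_rel n)"
        "\<And>k l. 0 < k \<Longrightarrow> k < l \<Longrightarrow> l < n \<Longrightarrow> z k l = g (k, l)"
        using complete_rel_cycle_extends by blast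
      obtain c where c: "c \<in> cycles W H" "contract c = z" using lift[OF z(1)] by blast
      obtain f where f: "coboundary f = c"
        using cycle_is_coboundary[OF finite_W c(1) HW(1)] .
      define f' where "f' F = f F + (f (0, 0) + g (0, 0))" for F
      have "coboundary f' = coboundary f"
        by (simp add: coboundary_def f'_def fun_eq_iff add_ac)
      moreover have "f' (0, 0) = g (0, 0)" by (simp add: f'_def)
      ultimately show ?thesis using f c z(2) by (intro exI[of _ f']) (auto simp: P_def)
    qed
    then obtain f where f: "\<And>g. coboundary (f g) \<in> cycles W H" "\<And>g. f g (0, 0) = g (0, 0)"
      "\<And>g k l. (k, l) \<in> P \<Longrightarrow> contract (coboundary (f g)) k l = g (k, l)"
      by (metis (mono_tags, lifting) case_prodD)
    \<comment> \<open>The coboundary is supported in \<open>H\<close>, so \<open>f g\<close> does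
      not change across other edges and is constant on regions.\<close>
    have f_r: "f g F' = f g F" if "(F, F') \<in> r\<^sup>*" for g F F'
      using that
    proof (induction rule: rtrancl_induct)
      case (step F' F'')
      then obtain p q where pq: "(p, q) \<in> grid" "(p, q) \<notin> H" "F' = left p q" "F'' = left q p"
        by (auto simp: r_def)
      then have "coboundary (f g) p q = 0"
        using cyclesD(2)[OF f(1)[of g]] by (metis bit_not_one_iff)
      then show ?case using pq step.IH by (simp add: coboundary_def bit_add_eq_0_iff)
    qed simp
    define pick where "pick \<rho> = (SOME F. F \<in> \<rho>)" for \<rho> :: "pt set"
    have pick: "f g (pick (reg F)) = f g F" for g F
    proof -
      have "pick (reg F) \<in> reg F" unfolding pick_def using reg_self by (rule someI)
      then show ?thesis using f_r by (simp add: reg_def)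
    qed
    \<comment> \<open>\<open>f g\<close> is known from one value per region, and \<open>g\<close>
      can be recovered from \<open>f g\<close>. Comparing powers of 2 then bounds the number of
      regions.\<close>
    let ?\<Phi> = "\<lambda>g. restrict (\<lambda>\<rho>. f g (pick \<rho>)) (range reg)"
    have "inj_on ?\<Phi> (Q \<rightarrow>\<^sub>E UNIV)"
    proof (rule inj_onI)
      fix g g' assume g: "g \<in> Q \<rightarrow>\<^sub>E UNIV" "g' \<in> Q \<rightarrow>\<^sub>E UNIV" "?\<Phi> g = ?\<Phi> g'"
      have "f g F = f g' F" for F
        using fun_cong[OF g(3), of "reg F"] by (simp add: pick)
      then have ff: "f g = f g'" by blast
      show "g = g'"
      proof (rule PiE_ext[OF g(1,2)])
        fix e assume "e \<in> Q"
        then show "g e = g' e"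
          using f(2)[of g] f(2)[of g'] f(3)[of _ _ g] f(3)[of _ _ g'] ff
          by (cases e) (auto simp: Q_def)
      qed
    qed
    moreover have "?\<Phi> ` (Q \<rightarrow>\<^sub>E UNIV) \<subseteq> range reg \<rightarrow>\<^sub>E UNIV" by auto
    moreover have bit: "(UNIV :: bit set) = {0, 1}" using bit.exhaust by blast
    then have "finite (UNIV :: bit set)" by (metis finite.simps)
    then have "finite (range reg \<rightarrow>\<^sub>E (UNIV :: bit set))" using fin by (intro finite_PiE)
    ultimately have "card (Q \<rightarrow>\<^sub>E (UNIV :: bit set)) \<le> card (range reg \<rightarrow>\<^sub>E (UNIV :: bit set))"
      by (rule card_inj_on_le)
    moreover have "card (UNIV :: bit set) = 2" by (simp add: bit)
    ultimately have "(2::nat) ^ Suc dim \<le> 2 ^ card (range reg)"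
      using fin cardQ by (simp only: card_PiE prod_constant)
    then show ?thesis by (rule power_le_imp_le_exp[rotated]) simp
  qed
  have boundary: "\<exists>z\<in>cycles {..<n} (complete_rel n). (\<exists>i j. z i j = 1) \<and>
         (\<forall>i j. z i j = 1 \<longrightarrow> reg F0 \<in> {reg (left (a i j) (a j i)), reg (left (a j i) (a i j))})"
    if ne: "range reg \<noteq> {reg F0}" for F0
  proof -
    \<comment> \<open>The coboundary of the indicator of a region is its boundary; it is nonzero
      because a second region exists.\<close>
    define f :: "pt \<Rightarrow> bit" where "f F = of_bool (F \<in> reg F0)" for F
    have f: "f F = 1 \<longleftrightarrow> reg F0 = reg F" for F
      using reg_eq[of F F0] by (auto simp: f_def)
    have cyc: "coboundary f \<in> cycles W H"
    proof (rule coboundary_in_cycles[OF finite_W HW(2)])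
      fix p q assume "(p, q) \<in> grid" "(p, q) \<notin> H"
      then have "(left p q, left q p) \<in> r" unfolding r_def by blast
      then have "left q p \<in> reg (left p q)" by (auto simp: reg_def)
      then have "reg (left q p) = reg (left p q)" using reg_eq by simp
      then show "f (left p q) = f (left q p)" using f by (metis bit_not_one_iff)
    qed
    obtain F1 where F1: "reg F1 \<noteq> reg F0" using ne by auto
    have "\<exists>p q. coboundary f p q \<noteq> 0"
    proof (rule ccontr)
      assume "\<not> ?thesis"
      then have "f F1 = f F0" by (intro coboundary_eq_0_imp_const) blast
      then show False using f F1 by metis
    qed
    \<comment> \<open>This is where the minimality of \<open>H\<close> enters: a nonzero cycle of
      \<open>H\<close> survives contraction.\<close>
    then obtain i j where "contract (coboundary f) i j \<noteq> 0"
      using faithful[OF cyc] by blast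
    then have "contract (coboundary f) i j = 1" by simp
    moreover have "coboundary f \<in> cycles W H0" using cyc H(1) unfolding cycles_def by blast
    then have "contract (coboundary f) \<in> cycles {..<n} (complete_rel n)"
      by (rule contract_in_cycles)
    moreover have "reg F0 \<in> {reg (left (a i j) (a j i)), reg (left (a j i) (a i j))}"
      if "contract (coboundary f) i j = 1" for i j
    proof -
      have "f (left (a i j) (a j i)) + f (left (a j i) (a i j)) = 1"
        using that by (auto simp: contract_def coboundary_def split: if_splits)
      then have "f (left (a i j) (a j i)) = 1 \<or> f (left (a j i) (a i j)) = 1"
        by (metis add.right_neutral bit_not_one_iff)
      then show ?thesis using f by blast
    qed
    ultimately show ?thesis by blast
  qed
  show ?thesis
    unfolding dim_def[symmetric]
    by (intro exI[of _ reg] conjI allI impI boundary) (use card in blast)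
qed

text \<open>Pairs of a region and an arc are counted twice. With two arcs for each edge of the
  complete graph, the contradiction reads 42 \<le> 40.\<close>

lemma no_five_branch_sets: "n \<noteq> 5"
proof
  assume n: "n = 5"
  let ?K = "complete_rel n"
  obtain reg :: "pt \<Rightarrow> pt set"
    where reg: "infinite (range reg) \<or> Suc (card {(k, l). 0 < k \<and> k < l \<and> l < n}) \<le> card (range reg)"
    and bd: "\<forall>F. range reg \<noteq> {reg F} \<longrightarrow>
       (\<exists>z\<in>cycles {..<n} ?K. (\<exists>i j. z i j = 1) \<and>
         (\<forall>i j. z i j = 1 \<longrightarrow> reg F \<in> {reg (left (a i j) (a j i)), reg (left (a j i) (a i j))}))"
    using regions_lower_bound by (elim exE conjE) (rule that; assumption)
  have "{(k, l). 0 < k \<and> k < l \<and> l < n} = {(1, 2), (1, 3), (1, 4), (2, 3), (2, 4), (3, 4)}"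
    unfolding n by auto
  then have "card {(k, l). 0 < k \<and> k < l \<and> l < n} = 6" by simp
  with reg have "infinite (range reg) \<or> 7 \<le> card (range reg)" by simp
  \<comment> \<open>Seven regions are enough, so the infinite case is treated alike.\<close>
  then obtain S where S: "S \<subseteq> range reg" "finite S" "card S = 7"
  proof
    assume "infinite (range reg)"
    then show ?thesis using infinite_arbitrarily_large that by metis
  next
    assume "7 \<le> card (range reg)"
    then show ?thesis by (rule obtain_subset_with_card_n) (use that in blast)
  qed
  have "\<exists>z\<in>cycles {..<n} ?K. (\<exists>i j. z i j = 1) \<and>
         (\<forall>i j. z i j = 1 \<longrightarrow> \<rho> \<in> {reg (left (a i j) (a j i)), reg (left (a j i) (a i j))})"
    if "\<rho> \<in> S" for \<rho>
  proof -
    obtain F where F: "\<rho> = reg F" using S \<open>\<rho> \<in> S\<close> by blast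
    have "range reg \<noteq> {reg F}"
    proof
      assume "range reg = {reg F}"
      then have "card S \<le> 1" using S(1) card_mono[of "{reg F}" S] by simp
      then show False using S by simp
    qed
    then show ?thesis unfolding F by (rule bd[rule_format])
  qed
  then obtain z where z: "\<And>\<rho>. \<rho> \<in> S \<Longrightarrow> z \<rho> \<in> cycles {..<n} ?K"
    "\<And>\<rho>. \<rho> \<in> S \<Longrightarrow> \<exists>i j. z \<rho> i j = 1"
    "\<And>\<rho> i j. \<rho> \<in> S \<Longrightarrow> z \<rho> i j = 1 \<Longrightarrow>
        \<rho> \<in> {reg (left (a i j) (a j i)), reg (left (a j i) (a i j))}"
    by metis
  have six: "6 \<le> card {(i, j) \<in> ?K. z \<rho> i j = 1}" if "\<rho> \<in> S" for \<rho>
  proof -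
    obtain i j where "z \<rho> i j = 1" using z(2) \<open>\<rho> \<in> S\<close> by blast
    then show ?thesis
      using z(1)[OF \<open>\<rho> \<in> S\<close>]
      by (intro cycle_card_ge_6[of "{..<n}"]) (auto simp: complete_rel_def)
  qed
  \<comment> \<open>Only the regions on the two sides of the connecting edge qualify.\<close>
  have "card {\<rho> \<in> S. z \<rho> (fst e) (snd e) = 1} \<le> 2" for e
  proof -
    obtain i j where e: "e = (i, j)" by (cases e)
    have "{\<rho> \<in> S. z \<rho> i j = 1} \<subseteq> {reg (left (a i j) (a j i)), reg (left (a j i) (a i j))}"
      using z(3) by blast
    then have "card {\<rho> \<in> S. z \<rho> i j = 1} \<le> card {reg (left (a i j) (a j i)), reg (left (a j i) (a i j))}"
      by (intro card_mono) auto
    also have "\<dots> \<le> 2" by (simp add: card_insert_if)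
    finally show ?thesis by (simp add: e)
  qed
  then have "(\<Sum>e\<in>?K. card {\<rho> \<in> S. z \<rho> (fst e) (snd e) = 1}) \<le> (\<Sum>e\<in>?K. 2)"
    by (intro sum_mono)
  moreover have "?K = {..<5} \<times> {..<5} - (\<lambda>i. (i, i)) ` {..<5}"
    unfolding n by (auto simp: complete_rel_def)
  then have "card ?K = 20"
    by (simp add: card_Diff_subset card_image inj_on_def image_subset_iff)
  moreover have "(\<Sum>e\<in>?K. card {\<rho> \<in> S. z \<rho> (fst e) (snd e) = 1}) =
      (\<Sum>\<rho>\<in>S. card {e \<in> ?K. z \<rho> (fst e) (snd e) = 1})"
    using S(2) finite_complete_rel by (intro sum_multicount_gen) auto
  moreover have "(\<Sum>\<rho>\<in>S. 6) \<le> (\<Sum>\<rho>\<in>S. card {e \<in> ?K. z \<rho> (fst e) (snd e) = 1})"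
    using six by (intro sum_mono) (simp add: case_prod_beta')
  ultimately show False using S(3) by simp
qed

end

section \<open>The two Cayley graphs\<close>

text \<open>The arcs are already symmetric and have both ends among the vertices, so neither the
  symmetric closure nor the restriction of walks to the vertex set changes anything.\<close>

lemma connected_pair_graph_iff:
  assumes "pair_graph G"
  shows "connected G \<longleftrightarrow> pverts G \<noteq> {} \<and> (\<forall>u\<in>pverts G. \<forall>v\<in>pverts G. (u, v) \<in> (parcs G)\<^sup>*)"
proof -
  interpret pair_graph G by fact
  have "(parcs G)\<^sup>s = parcs G"
    using arcs_symmetric by (auto simp: symcl_def)
  moreover have "(u, v) \<in> rtrancl_on (pverts G) (parcs G) \<longleftrightarrow> (u, v) \<in> (parcs G)\<^sup>*"
    if "u \<in> pverts G" "v \<in> pverts G" for u v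
    using that in_arcsD2
    by (auto intro: rtrancl_on_rtranclI rtrancl_consistent_rtrancl_on)
  ultimately show ?thesis by (simp add: connected_conv)
qed

lemma parcs_Cay_iff: "(u, v) \<in> parcs (Cay S) \<longleftrightarrow> u - v \<in> S"
  by (auto simp: Cay_def) (metis diff_add_cancel)

lemma parcs_Cay_S1: "parcs (Cay {(1, 0), (-1, 0), (0, 1), (0, -1) :: int \<times> int}) = grid"
  by (auto simp: parcs_Cay_iff grid_def)

lemma grid_minor_excluded: "minor_excluded (Cay {(1, 0), (-1, 0), (0, 1), (0, -1) :: int \<times> int})"
proof -
  let ?G = "Cay {(1, 0), (-1, 0), (0, 1), (0, -1) :: int \<times> int}"
  define M :: "nat pair_pre_digraph" where "M = \<lparr> pverts = {..<5}, parcs = complete_rel 5 \<rparr>"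
  have "finite (complete_rel 5)"
    by (rule finite_subset[of _ "{..<5} \<times> {..<5}"]) (auto simp: complete_rel_def)
  then have "pair_graph M"
    by unfold_locales (auto simp: M_def complete_rel_def symmetric_def sym_def)
  moreover have "\<not> is_minor M ?G"
  proof
    assume "is_minor M ?G"
    then obtain B where
        B: "\<forall>i\<in>pverts M. pair_graph (B i) \<and> subgraph (B i) ?G \<and> connected (B i)"
      and disj: "\<forall>i\<in>pverts M. \<forall>j\<in>pverts M. i \<noteq> j \<longrightarrow> pverts (B i) \<inter> pverts (B j) = {}"
      and edge: "\<forall>(i, j)\<in>parcs M. \<exists>x\<in>pverts (B i). \<exists>y\<in>pverts (B j). (x, y) \<in> parcs ?G"
      unfolding is_minor_def by blast
    have pg: "pair_graph (B i)" and sg: "subgraph (B i) ?G" and con: "connected (B i)"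
      if "i < 5" for i
      using B that by (simp_all add: M_def)
    have edge: "\<exists>x\<in>pverts (B i). \<exists>y\<in>pverts (B j). (x, y) \<in> grid"
      if "(i, j) \<in> complete_rel 5" for i j
      using edge that unfolding parcs_Cay_S1 M_def by fastforce
    obtain x y where xy: "\<And>i j. (i, j) \<in> complete_rel 5 \<Longrightarrow>
       x i j \<in> pverts (B i) \<and> y i j \<in> pverts (B j) \<and> (x i j, y i j) \<in> grid"
      using edge by metis
    \<comment> \<open>The edges chosen for (i, j) and (j, i) may differ. Taking both ends from the
      choice with the smaller index first makes \<open>a i j\<close> and \<open>a j i\<close> ends
      of one edge.\<close>
    define a where "a i j = (if i < j then x i j else y j i)" for i j
    have ji: "(i, j) \<in> complete_rel 5 \<Longrightarrow> (j, i) \<in> complete_rel 5" for i j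
      by (auto simp: complete_rel_def)
    have a: "a i j \<in> pverts (B i)" "(a i j, a j i) \<in> grid" if "(i, j) \<in> complete_rel 5" for i j
      using xy[OF that] xy[OF ji[OF that]] that grid_sym
      by (auto simp: a_def complete_rel_def)
    interpret complete_minor_in_grid 5 "\<lambda>i. pverts (B i)" "\<lambda>i. parcs (B i)" a
    proof
      fix i :: nat assume i: "i < 5"
      interpret Bi: pair_graph "B i" by (rule pg[OF i])
      show "finite (pverts (B i))" by (rule Bi.pair_finite_verts)
      show "parcs (B i) \<subseteq> pverts (B i) \<times> pverts (B i)"
        using Bi.in_arcsD1 Bi.in_arcsD2 by auto
      show "sym (parcs (B i))" using Bi.arcs_symmetric by (blast intro: symI)
      show "(p, p) \<notin> parcs (B i)" for p using Bi.no_loops' by blast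
      show "(p, q) \<in> (parcs (B i))\<^sup>*" if "p \<in> pverts (B i)" "q \<in> pverts (B i)" for p q
        using connected_pair_graph_iff[OF pg[OF i]] con[OF i] that by blast
      show "parcs (B i) \<subseteq> grid"
        using sg[OF i] by (simp add: subgraph_def parcs_Cay_S1)
    qed (use disj a in \<open>auto simp: M_def\<close>)
    show False using no_five_branch_sets by simp
  qed
  ultimately show ?thesis unfolding minor_excluded_def by blast
qed

text \<open>Any two of the branch sets touch: column 2i + 1 passes beside the point (2i, j) of row
  j.\<close>

lemma double_step_grid_not_minor_excluded:
  "\<not> minor_excluded (Cay {(1, 0), (-1, 0), (2, 0), (-2, 0), (0, 1), (0, -1) :: int \<times> int})"
proof -
  define S where "S = {(1, 0), (-1, 0), (2, 0), (-2, 0), (0, 1), (0, -1) :: int \<times> int}"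
  interpret G: pair_bidirected_digraph "Cay S"
    unfolding S_def by (rule pair_bidirected_digraph_Cay[OF connection_set_S2])
  have "is_minor M (Cay S)" if M: "pair_graph M" for M :: "nat pair_pre_digraph"
  proof -
    interpret M: pair_graph M by (rule M)
    \<comment> \<open>The vertices of \<open>M\<close> may be any finite set of numbers; the
      construction serves all i < N at once.\<close>
    obtain N where N: "\<And>i. i \<in> pverts M \<Longrightarrow> i < N"
      using M.pair_finite_verts finite_nat_set_iff_bounded by metis
    \<comment> \<open>Length \<open>N\<close> lets every row reach the points beside all columns,
      and every column the height of all rows.\<close>
    define row col V where "row i = (\<lambda>k. (2 * int k, int i)) ` {..<N}"
      and "col i = (\<lambda>y. (2 * int i + 1, int y)) ` {..<N}" and "V i = row i \<union> col i" for i :: nat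
    define B where "B i = \<lparr> pverts = V i, parcs = parcs (Cay S) \<inter> V i \<times> V i \<rparr>" for i
    have pg: "pair_graph (B i)" for i
    proof
      show "finite (pverts (B i))" by (simp add: B_def V_def row_def col_def)
      then show "finite (parcs (B i))" by (auto simp: B_def intro: finite_subset)
      show "symmetric (with_proj (B i))"
        using G.arcs_symmetric by (auto simp: symmetric_def B_def intro!: symI)
      show "fst e \<noteq> snd e" if "e \<in> parcs (B i)" for e
        using G.pair_no_loops that by (simp add: B_def)
    qed (auto simp: B_def)
    have sg: "subgraph (B i) (Cay S)" for i
    proof -
      interpret pair_graph "B i" by (rule pg)
      show ?thesis
        using G.wf_digraph_axioms wf_digraph_axioms
        by (simp add: subgraph_def compatible_def) (simp add: B_def Cay_def)
    qed
    have conn: "connected (B i)" if i: "i < N" for i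
    proof -
      let ?R = "(parcs (B i))\<^sup>*"
      interpret Bi: pair_graph "B i" by (rule pg)
      have symR: "(v, u) \<in> ?R" if "(u, v) \<in> ?R" for u v
        using that Bi.arcs_symmetric by (meson symD symI sym_rtrancl)
      have rowV: "(2 * int k, int i) \<in> V i" and colV: "(2 * int i + 1, int k) \<in> V i"
        if "k < N" for k
        using that unfolding V_def row_def col_def by blast+
      have rowc: "((2 * int k, int i), (0, int i)) \<in> ?R" if "k < N" for k
        using that
      proof (induction k)
        case (Suc k)
        then have "((2 * int (Suc k), int i), (2 * int k, int i)) \<in> parcs (B i)"
          using rowV[of k] rowV[of "Suc k"] by (simp add: B_def parcs_Cay_iff S_def)
        then show ?case using Suc by (meson Suc_lessD converse_rtrancl_into_rtrancl)
      qed simp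
      have colc: "((2 * int i + 1, int y), (2 * int i + 1, 0)) \<in> ?R" if "y < N" for y
        using that
      proof (induction y)
        case (Suc y)
        then have "((2 * int i + 1, int (Suc y)), (2 * int i + 1, int y)) \<in> parcs (B i)"
          using colV[of y] colV[of "Suc y"] by (simp add: B_def parcs_Cay_iff S_def)
        then show ?case using Suc by (meson Suc_lessD converse_rtrancl_into_rtrancl)
      qed simp
      \<comment> \<open>A unit step at height i joins column and row of the same branch set.\<close>
      have "((2 * int i + 1, int i), (2 * int i, int i)) \<in> parcs (B i)"
        using rowV[OF i] colV[OF i] by (simp add: B_def parcs_Cay_iff S_def)
      then have "((2 * int i + 1, 0), (0, int i)) \<in> ?R"
        using symR[OF colc[OF i]] rowc[OF i] by (meson r_into_rtrancl rtrancl_trans)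
      then have hub: "(u, (0, int i)) \<in> ?R" if "u \<in> V i" for u
        using that rowc colc by (auto simp: V_def row_def col_def intro: rtrancl_trans)
      have "(u, v) \<in> ?R" if "u \<in> V i" "v \<in> V i" for u v
        using hub that symR by (meson rtrancl_trans)
      moreover have "V i \<noteq> {}" using i by (auto simp: V_def row_def)
      ultimately show ?thesis
        using connected_pair_graph_iff[OF pg] by (simp add: B_def)
    qed
    \<comment> \<open>The parity of the first coordinate separates rows from columns.\<close>
    have disj: "V i \<inter> V j = {}" if "i \<noteq> j" for i j
      using that by (auto simp: V_def row_def col_def) presburger+
    have edge: "\<exists>x\<in>V i. \<exists>y\<in>V j. (x, y) \<in> parcs (Cay S)" if "i < N" "j < N" for i j
    proof (intro bexI)
      show "((2 * int i + 1, int j), (2 * int i, int j)) \<in> parcs (Cay S)"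
        by (simp add: parcs_Cay_iff S_def)
    qed (use that in \<open>auto simp: V_def row_def col_def\<close>)
    show ?thesis
      unfolding is_minor_def
    proof (intro exI[of _ B] conjI)
      show "\<forall>(i, j)\<in>parcs M. \<exists>x\<in>pverts (B i). \<exists>y\<in>pverts (B j). (x, y) \<in> parcs (Cay S)"
      proof
        fix e assume "e \<in> parcs M"
        then have "fst e < N" "snd e < N" using M.arc_fst_in_verts M.arc_snd_in_verts N by blast+
        then show "case e of (i, j) \<Rightarrow> \<exists>x\<in>pverts (B i). \<exists>y\<in>pverts (B j). (x, y) \<in> parcs (Cay S)"
          using edge by (simp add: B_def split_beta)
      qed
    next
      show "\<forall>i\<in>pverts M. pair_graph (B i) \<and> subgraph (B i) (Cay S) \<and> connected (B i)"
        using pg sg conn N by blast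
      show "\<forall>i\<in>pverts M. \<forall>j\<in>pverts M. i \<noteq> j \<longrightarrow> pverts (B i) \<inter> pverts (B j) = {}"
        using disj by (simp add: B_def)
    qed
  qed
  then show ?thesis unfolding minor_excluded_def S_def by blast
qed

theorem mainTheorem7:
  fixes S\<^sub>1 S\<^sub>2 :: "(int \<times> int) set"
  assumes "S\<^sub>1 = {(1, 0), (-1, 0), (0, 1), (0, -1)}"
    and "S\<^sub>2 = {(1, 0), (-1, 0), (2, 0), (-2, 0), (0, 1), (0, -1)}"
  shows "minor_excluded (Cay S\<^sub>1) \<and> \<not> minor_excluded (Cay S\<^sub>2)"
  using assms grid_minor_excluded double_step_grid_not_minor_excluded by simp

end
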